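(* Let $T$ be a (non-degenerate) triangle in the plane with boundary $\partial(T)$. Let $P_1=(x_1,y_1)$ and $P_2=(x_2,y_2)$ be distinct points which lie on different sides of $\partial(T)$, and assume that neither $P_1$ nor $P_2$ equals one of the vertices of $T$. Then there is a unique ellipse inscribed in $T$ which is tangent to $\partial(T)$ at $P_1$ and at $P_2$.
   Context: An ellipse (circles included) is inscribed in the triangle $T$ if it lies in $T$ (the closed triangular region) and is tangent to each side of $T$. *)

theory Defs
  imports "HOL-Analysis.Analysis"
begin

text \<open>The ellipse is the curve, not the region it bounds. The strict inequality excludes the
  degenerate case of a segment; equal foci give the circles.\<close>

definition is_ellipse :: "(real^2) set \<Rightarrow> bool" where
  "is_ellipse E \<longleftrightarrow>
     (\<exists>f g a. dist f g < 2 * a \<and> E = {p. dist p f + dist p g = 2 * a})"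

text \<open>Velocities of two-sided curves: a segment has no nonzero tangent vector at an endpoint,
  and the boundary of a triangle has none at a vertex.\<close>

definition tangent_vector :: "'a::real_normed_vector set \<Rightarrow> 'a \<Rightarrow> 'a \<Rightarrow> bool" where
  "tangent_vector S p v \<longleftrightarrow>
     (\<exists>\<gamma> :: real \<Rightarrow> 'a. \<gamma> 0 = p \<and> (\<forall>\<^sub>F t in nhds 0. \<gamma> t \<in> S) \<and>
        (\<gamma> has_vector_derivative v) (at 0))"

text \<open>Tangency of plane curves: they meet at the point and share a tangent direction there.\<close>

definition tangent_at :: "(real^2) set \<Rightarrow> (real^2) set \<Rightarrow> real^2 \<Rightarrow> bool" where
  "tangent_at S S' p \<longleftrightarrow>
     p \<in> S \<and> p \<in> S' \<and> (\<exists>v. v \<noteq> 0 \<and> tangent_vector S p v \<and> tangent_vector S' p v)"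

definition triangle_region :: "real^2 \<Rightarrow> real^2 \<Rightarrow> real^2 \<Rightarrow> (real^2) set" where
  "triangle_region A B C = convex hull {A, B, C}"

definition sides :: "real^2 \<Rightarrow> real^2 \<Rightarrow> real^2 \<Rightarrow> (real^2) set set" where
  "sides A B C = {closed_segment A B, closed_segment B C, closed_segment C A}"

definition inscribed_ellipse ::
    "(real^2) set \<Rightarrow> real^2 \<Rightarrow> real^2 \<Rightarrow> real^2 \<Rightarrow> bool" where
  "inscribed_ellipse E A B C \<longleftrightarrow>
     is_ellipse E \<and> E \<subseteq> triangle_region A B C \<and> (\<forall>s \<in> sides A B C. \<exists>p. tangent_at E s p)"

end

theory Submission
  imports Defs
begin

text \<open>An ellipse is the same as the zero set of some \<open>Q p = B (p - c) (p - c) - 1\<close> with \<open>B\<close> positive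
  definite. If it lies in a triangle, then \<open>Q\<close> is nonnegative on the side lines, since a point where
  \<open>Q\<close> is negative lies between two points of the ellipse in any direction; so a common point with a
  side is a double root of \<open>Q\<close> on that line. Take the common vertex of the sides of \<open>P1\<close> and \<open>P2\<close> as
  origin and \<open>P1\<close>, \<open>P2\<close> as unit points of affine coordinates. Up to a factor, the double roots on the
  two axes force \<open>Q = (x + y - 1)\<^sup>2 - k x y\<close>, and the double root on the third side determines \<open>k\<close>;
  conversely, the conic with this \<open>k\<close> is an ellipse with the required properties.\<close>

section \<open>Ellipses as unit spheres of positive definite forms\<close>

definition posdef_form :: "('a::real_vector \<Rightarrow> 'a \<Rightarrow> real) \<Rightarrow> bool" where
  "posdef_form B \<longleftrightarrow> bilinear B \<and> (\<forall>x y. B x y = B y x) \<and> (\<forall>x. x \<noteq> 0 \<longrightarrow> 0 < B x x)"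

definition unit_conic :: "('a::real_vector \<Rightarrow> 'a \<Rightarrow> real) \<Rightarrow> 'a \<Rightarrow> 'a set" where
  "unit_conic B c = {p. B (p - c) (p - c) = 1}"

lemma posdef_form_pos: "posdef_form B \<Longrightarrow> x \<noteq> 0 \<Longrightarrow> 0 < B x x"
  by (simp add: posdef_form_def)

lemma posdef_form_expand:
  assumes "posdef_form B"
  shows "B (x *\<^sub>R p + y *\<^sub>R q) (x *\<^sub>R p + y *\<^sub>R q) = x\<^sup>2 * B p p + 2 * x * y * B p q + y\<^sup>2 * B q q"
proof -
  have b: "bilinear B" and "B q p = B p q"
    using assms by (auto simp: posdef_form_def)
  then show ?thesis
    by (simp add: bilinear_ladd[OF b] bilinear_radd[OF b] bilinear_lmul[OF b] bilinear_rmul[OF b]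
        algebra_simps power2_eq_square)
qed

lemma posdef_form_expand_line:
  assumes "posdef_form B"
  shows "B (p + t *\<^sub>R v) (p + t *\<^sub>R v) = B p p + 2 * t * B p v + t\<^sup>2 * B v v"
  using posdef_form_expand[OF assms, of 1 p t v] by simp

lemma posdef_form_expand_plane:
  assumes "posdef_form B"
  shows "B (z + (x *\<^sub>R p + y *\<^sub>R q)) (z + (x *\<^sub>R p + y *\<^sub>R q)) =
    B p p * x\<^sup>2 + 2 * B p q * x * y + B q q * y\<^sup>2 + 2 * B z p * x + 2 * B z q * y + B z z"
proof -
  have b: "bilinear B"
    using assms by (auto simp: posdef_form_def)
  show ?thesis
    using posdef_form_expand_line[OF assms, of z 1 "x *\<^sub>R p + y *\<^sub>R q"]
      posdef_form_expand[OF assms, of x p y q]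
    by (simp add: bilinear_radd[OF b] bilinear_rmul[OF b] algebra_simps)
qed

section \<open>Focal equation versus quadratic equation\<close>

text \<open>Both equations say that the focal distances are \<open>a - r\<close> and
  \<open>a + r\<close> with \<open>r = (w \<bullet> h) / a\<close>: their squares differ by
  \<open>4 * a * r\<close>, so the sum \<open>2 * a\<close> forces the difference
  \<open>2 * r\<close>.\<close>

lemma focal_sum_iff:
  fixes w h :: "'a::real_inner"
  assumes a: "norm h < a"
  shows "norm (w - h) + norm (w + h) = 2 * a \<longleftrightarrow>
    a\<^sup>2 * (w \<bullet> w) - (w \<bullet> h)\<^sup>2 = a\<^sup>2 * (a\<^sup>2 - h \<bullet> h)"
proof -
  have a0: "0 < a"
    using a norm_ge_zero[of h] by linarith
  have ha: "h \<bullet> h < a\<^sup>2"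
    using a by (simp add: power_strict_mono flip: power2_norm_eq_inner)
  have sm: "(norm (w - h))\<^sup>2 = w \<bullet> w - 2 * (w \<bullet> h) + h \<bullet> h"
    and sp: "(norm (w + h))\<^sup>2 = w \<bullet> w + 2 * (w \<bullet> h) + h \<bullet> h"
    by (simp_all add: power2_norm_eq_inner inner_diff_left inner_diff_right inner_add_left
        inner_add_right inner_commute)
  define r where "r = (w \<bullet> h) / a"
  have r: "w \<bullet> h = r * a"
    using a0 by (simp add: r_def)
  show ?thesis
  proof
    assume s: "norm (w - h) + norm (w + h) = 2 * a"
    have "(norm (w + h))\<^sup>2 - (norm (w - h))\<^sup>2 = 4 * a * r"
      by (simp add: sm sp r)
    then have "(norm (w + h) - norm (w - h)) * (norm (w - h) + norm (w + h)) = 4 * a * r"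
      by (simp add: algebra_simps power2_eq_square)
    then have "norm (w + h) - norm (w - h) = 2 * r"
      using a0 unfolding s by simp
    then have "norm (w + h) = a + r"
      using s by simp
    then have "w \<bullet> w + 2 * (r * a) + h \<bullet> h = (a + r)\<^sup>2"
      using sp r by simp
    then have "w \<bullet> w + h \<bullet> h = a\<^sup>2 + r\<^sup>2"
      by (simp add: power2_eq_square algebra_simps)
    then have "a\<^sup>2 * (w \<bullet> w + h \<bullet> h) = a\<^sup>2 * (a\<^sup>2 + r\<^sup>2)"
      by simp
    then show "a\<^sup>2 * (w \<bullet> w) - (w \<bullet> h)\<^sup>2 = a\<^sup>2 * (a\<^sup>2 - h \<bullet> h)"
      by (simp add: r power_mult_distrib algebra_simps)
  next
    assume e: "a\<^sup>2 * (w \<bullet> w) - (w \<bullet> h)\<^sup>2 = a\<^sup>2 * (a\<^sup>2 - h \<bullet> h)"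
    then have "a\<^sup>2 * (w \<bullet> w + h \<bullet> h) = a\<^sup>2 * (a\<^sup>2 + r\<^sup>2)"
      by (simp add: r power_mult_distrib algebra_simps)
    then have k: "w \<bullet> w + h \<bullet> h = a\<^sup>2 + r\<^sup>2"
      using a0 by simp
    \<comment> \<open>Cauchy-Schwarz settles the signs of the square roots: it yields
      \<open>w \<bullet> w \<le> a\<^sup>2\<close> and from this
      \<open>\<bar>r\<bar> \<le> a\<close>.\<close>
    have "(w \<bullet> h)\<^sup>2 \<le> (w \<bullet> w) * (h \<bullet> h)"
      by (rule Cauchy_Schwarz_ineq)
    then have "a\<^sup>2 * (w \<bullet> w) - a\<^sup>2 * (a\<^sup>2 - h \<bullet> h) \<le> (w \<bullet> w) * (h \<bullet> h)"
      using e by simp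
    then have "(w \<bullet> w - a\<^sup>2) * (a\<^sup>2 - h \<bullet> h) \<le> 0"
      by (simp add: algebra_simps)
    then have "w \<bullet> w \<le> a\<^sup>2"
      using ha by (simp add: mult_le_0_iff)
    then have "r\<^sup>2 \<le> a\<^sup>2"
      using k ha by linarith
    then have "\<bar>r\<bar> \<le> a"
      using a0 by (simp add: abs_le_square_iff[symmetric])
    moreover have "(norm (w - h))\<^sup>2 = (a - r)\<^sup>2" "(norm (w + h))\<^sup>2 = (a + r)\<^sup>2"
      unfolding sm sp r using k by (simp_all add: power2_eq_square algebra_simps)
    ultimately have "norm (w - h) = a - r" "norm (w + h) = a + r"
      by (simp_all add: power2_eq_iff_nonneg)
    then show "norm (w - h) + norm (w + h) = 2 * a"
      by simp
  qed
qed

text \<open>With centre \<open>c\<close> and half focal vector \<open>h\<close>, the equation of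
  \<open>focal_sum_iff\<close> divided by its right-hand side \<open>D\<close> has level 1.
  Cauchy-Schwarz and \<open>norm h < a\<close> give positive definiteness.\<close>

lemma ellipse_is_conic:
  assumes "is_ellipse E"
  obtains B c where "posdef_form B" "E = unit_conic B c"
proof -
  obtain f g a where fg: "dist f g < 2 * a" and E: "E = {p. dist p f + dist p g = 2 * a}"
    using assms by (auto simp: is_ellipse_def)
  define c where "c = (1/2) *\<^sub>R (f + g)"
  define h where "h = (1/2) *\<^sub>R (f - g)"
  have f: "f = c + h" and g: "g = c - h"
    by (simp_all add: c_def h_def scaleR_add_right scaleR_diff_right flip: scaleR_left_distrib)
  have ha: "norm h < a"
    using fg by (simp add: h_def dist_norm)
  then have a0: "0 < a"
    using norm_ge_zero[of h] by linarith
  have hh: "h \<bullet> h < a\<^sup>2"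
    using ha by (simp add: power_strict_mono flip: power2_norm_eq_inner)
  define D where "D = a\<^sup>2 * (a\<^sup>2 - h \<bullet> h)"
  have D: "0 < D"
    using hh a0 by (simp add: D_def)
  define B where "B x y = (a\<^sup>2 * (x \<bullet> y) - (x \<bullet> h) * (y \<bullet> h)) / D" for x y :: "real^2"
  have "bilinear B"
    by (auto simp: bilinear_def linear_iff B_def inner_add_left inner_add_right algebra_simps
        add_divide_distrib diff_divide_distrib)
  moreover have "0 < B x x" if "x \<noteq> 0" for x
  proof -
    have "(x \<bullet> h)\<^sup>2 \<le> (x \<bullet> x) * (h \<bullet> h)"
      by (rule Cauchy_Schwarz_ineq)
    also have "\<dots> < (x \<bullet> x) * a\<^sup>2"
      using that hh by (simp add: mult_strict_left_mono)
    finally show ?thesis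
      using D by (simp add: B_def power2_eq_square algebra_simps)
  qed
  ultimately have "posdef_form B"
    by (simp add: posdef_form_def) (simp add: B_def inner_commute mult.commute)
  moreover have "E = unit_conic B c"
  proof -
    have "dist p f + dist p g = 2 * a \<longleftrightarrow> B (p - c) (p - c) = 1" for p
    proof -
      have "dist p f = norm ((p - c) - h)" "dist p g = norm ((p - c) + h)"
        by (simp_all add: dist_norm f g algebra_simps)
      then show ?thesis
        using focal_sum_iff[OF ha, of "p - c"] D
        by (auto simp: B_def simp flip: D_def power2_eq_square)
    qed
    then show ?thesis
      by (auto simp: E unit_conic_def)
  qed
  ultimately show ?thesis
    by (rule that)
qed

text \<open>With \<open>l\<close> the larger eigenvalue of the form, \<open>l \<bar>w\<bar>\<^sup>2 - B w w\<close> is positive semidefinite of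
  rank at most one, hence the square of a linear functional; its vector points towards the foci.\<close>

lemma posdef_form_spectral:
  fixes B :: "real^2 \<Rightarrow> real^2 \<Rightarrow> real"
  assumes "posdef_form B"
  obtains l k where "k \<bullet> k < l" "\<And>w. B w w = l * (w \<bullet> w) - (w \<bullet> k)\<^sup>2"
proof -
  define e1 e2 :: "real^2" where "e1 = axis 1 1" and "e2 = axis 2 1"
  define \<alpha> \<beta> \<gamma> where "\<alpha> = B e1 e1" and "\<beta> = B e1 e2" and "\<gamma> = B e2 e2"
  have dec: "w = (w $ 1) *\<^sub>R e1 + (w $ 2) *\<^sub>R e2" for w
    by (simp add: vec_eq_iff forall_2 e1_def e2_def axis_def)
  have Bw: "B w w = \<alpha> * (w $ 1)\<^sup>2 + 2 * \<beta> * (w $ 1) * (w $ 2) + \<gamma> * (w $ 2)\<^sup>2" for w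
    using posdef_form_expand[OF assms, of "w $ 1" e1 "w $ 2" e2] dec[of w]
    by (simp add: \<alpha>_def \<beta>_def \<gamma>_def algebra_simps)
  have \<alpha>: "0 < \<alpha>"
    unfolding \<alpha>_def using assms by (rule posdef_form_pos) (simp add: e1_def axis_def vec_eq_iff)
  have disc: "\<beta>\<^sup>2 < \<alpha> * \<gamma>"
  proof -
    \<comment> \<open>This vector is conjugate to \<open>e1\<close>, so the form takes there the
      value \<open>\<alpha>\<close> times the determinant.\<close>
    let ?w = "vector [- \<beta>, \<alpha>] :: real^2"
    have "?w \<noteq> 0"
      using \<alpha> by (simp add: vec_eq_iff forall_2)
    then have "0 < B ?w ?w"
      using assms by (simp add: posdef_form_pos)
    also have "B ?w ?w = \<alpha> * (\<alpha> * \<gamma> - \<beta>\<^sup>2)"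
      by (simp add: Bw power2_eq_square algebra_simps)
    finally show ?thesis
      using \<alpha> by (simp add: zero_less_mult_iff)
  qed
  have \<gamma>: "0 < \<gamma>"
    using disc \<alpha> by (metis le_less_trans zero_le_power2 zero_less_mult_pos)
  \<comment> \<open>The gap between the two eigenvalues, whose sum is the trace
    \<open>\<alpha> + \<gamma>\<close>; the bound \<open>d < \<alpha> + \<gamma>\<close> below says
    that the smaller one is positive.\<close>
  define d where "d = sqrt ((\<alpha> - \<gamma>)\<^sup>2 + 4 * \<beta>\<^sup>2)"
  have d2: "d\<^sup>2 = (\<alpha> - \<gamma>)\<^sup>2 + 4 * \<beta>\<^sup>2"
    by (simp add: d_def)
  have d: "\<bar>\<alpha> - \<gamma>\<bar> \<le> d"
    unfolding d_def by (rule real_le_rsqrt) simp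
  have "d\<^sup>2 < (\<alpha> + \<gamma>)\<^sup>2"
    using disc unfolding d2 by (simp add: power2_eq_square algebra_simps)
  then have dlt: "d < \<alpha> + \<gamma>"
    using \<alpha> \<gamma> by (simp add: power_less_imp_less_base)
  define l where "l = (\<alpha> + \<gamma> + d) / 2"
  \<comment> \<open>The components of \<open>k\<close>. As \<open>l\<close> is a root of the
    characteristic polynomial, \<open>\<bar>x * y\<bar> = \<bar>\<beta>\<bar>\<close>; the sign of
    \<open>y\<close> is chosen to give \<open>x * y = - \<beta>\<close>.\<close>
  define x y where "x = sqrt (l - \<alpha>)" and "y = (if \<beta> \<ge> 0 then - 1 else 1) * sqrt (l - \<gamma>)"
  have la: "0 \<le> l - \<alpha>" "0 \<le> l - \<gamma>"
    using d by (auto simp: l_def field_simps)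
  have x2: "x\<^sup>2 = l - \<alpha>" and y2: "y\<^sup>2 = l - \<gamma>"
    using la by (auto simp: x_def y_def)
  have "(l - \<alpha>) * (l - \<gamma>) = (d\<^sup>2 - (\<alpha> - \<gamma>)\<^sup>2) / 4"
    by (simp add: l_def power2_eq_square field_simps)
  then have "(l - \<alpha>) * (l - \<gamma>) = \<beta>\<^sup>2"
    by (simp add: d2)
  then have "sqrt (l - \<alpha>) * sqrt (l - \<gamma>) = \<bar>\<beta>\<bar>"
    by (simp flip: real_sqrt_mult)
  then have xy: "x * y = - \<beta>"
    by (auto simp: x_def y_def)
  define k :: "real^2" where "k = vector [x, y]"
  have kk: "k \<bullet> k = x\<^sup>2 + y\<^sup>2"
    by (simp add: k_def inner_vec_def sum_2 power2_eq_square)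
  have "B w w = l * (w \<bullet> w) - (w \<bullet> k)\<^sup>2" for w
  proof -
    have "w \<bullet> w = (w $ 1)\<^sup>2 + (w $ 2)\<^sup>2" and wk: "w \<bullet> k = w $ 1 * x + w $ 2 * y"
      by (simp_all add: k_def inner_vec_def sum_2 power2_eq_square)
    moreover have "(w \<bullet> k)\<^sup>2 = (w $ 1)\<^sup>2 * x\<^sup>2 + 2 * (w $ 1) * (w $ 2) * (x * y) + (w $ 2)\<^sup>2 * y\<^sup>2"
      unfolding wk by (simp add: power2_eq_square algebra_simps)
    ultimately show ?thesis
      unfolding Bw x2 y2 xy by (simp add: algebra_simps)
  qed
  moreover have "k \<bullet> k < l"
    using dlt unfolding kk x2 y2 by (simp add: l_def field_simps)
  ultimately show ?thesis
    using that by blast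
qed

text \<open>The eigenvalues of \<open>B\<close> are \<open>l - k \<bullet> k\<close> along
  \<open>k\<close> and \<open>l\<close> across it, and their reciprocals are the squared semi-axes.
  So \<open>a\<close> is the semi-major axis, and the foci are displaced from \<open>c\<close> along
  \<open>k\<close>; they coincide if \<open>k = 0\<close>.\<close>

lemma conic_is_ellipse:
  assumes "posdef_form B"
  shows "is_ellipse (unit_conic B c)"
proof -
  obtain l k where kl: "k \<bullet> k < l" and B: "\<And>w. B w w = l * (w \<bullet> w) - (w \<bullet> k)\<^sup>2"
    using posdef_form_spectral[OF assms] by metis
  have l: "0 < l"
    using kl inner_ge_zero[of k] by linarith
  define a where "a = 1 / sqrt (l - k \<bullet> k)"
  have a0: "0 < a" and a2: "a\<^sup>2 = 1 / (l - k \<bullet> k)"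
    using kl by (simp_all add: a_def power_divide)
  \<comment> \<open>The factor is chosen so that \<open>a\<^sup>2 - h \<bullet> h\<close> becomes
    \<open>1 / l\<close>, the squared semi-minor axis.\<close>
  define h where "h = (a / sqrt l) *\<^sub>R k"
  have hh: "h \<bullet> h = a\<^sup>2 * (k \<bullet> k) / l" and wh: "(w \<bullet> h)\<^sup>2 = a\<^sup>2 * (w \<bullet> k)\<^sup>2 / l" for w
    using l by (simp_all add: h_def power_divide power_mult_distrib power2_eq_square[of a])
  have "a\<^sup>2 * (k \<bullet> k) / l < a\<^sup>2 * 1"
    using kl l a0 by (simp add: field_simps)
  then have "(norm h)\<^sup>2 < a\<^sup>2"
    by (simp add: power2_norm_eq_inner hh)
  then have ha: "norm h < a"
    using a0 by (simp add: power_less_imp_less_base)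
  have "dist p (c + h) + dist p (c - h) = 2 * a \<longleftrightarrow> B (p - c) (p - c) = 1" for p
  proof -
    have "dist p (c + h) = norm ((p - c) - h)" "dist p (c - h) = norm ((p - c) + h)"
      by (simp_all add: dist_norm algebra_simps)
    then have "dist p (c + h) + dist p (c - h) = 2 * a \<longleftrightarrow>
        a\<^sup>2 * ((p - c) \<bullet> (p - c)) - ((p - c) \<bullet> h)\<^sup>2 = a\<^sup>2 * (a\<^sup>2 - h \<bullet> h)"
      using focal_sum_iff[OF ha, of "p - c"] by simp
    also have "\<dots> \<longleftrightarrow> (a\<^sup>2 / l) * B (p - c) (p - c) = a\<^sup>2 * (a\<^sup>2 - h \<bullet> h)"
      using l by (simp add: B wh field_simps)
    also have "a\<^sup>2 - h \<bullet> h = 1 / l"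
      proof -
      have "a\<^sup>2 - h \<bullet> h = a\<^sup>2 * (l - k \<bullet> k) / l"
        using l by (simp add: hh field_simps)
      also have "a\<^sup>2 * (l - k \<bullet> k) = 1"
        using kl by (simp add: a2)
      finally show ?thesis .
    qed
    finally show ?thesis
      using l a0 by (simp add: field_simps)
  qed
  then have "unit_conic B c = {p. dist p (c + h) + dist p (c - h) = 2 * a}"
    by (simp add: unit_conic_def)
  moreover have "dist (c + h) (c - h) < 2 * a"
  proof -
    have "dist (c + h) (c - h) = norm (2 *\<^sub>R h)"
      by (simp add: dist_norm scaleR_2)
    then show ?thesis
      using ha by simp
  qed
  ultimately show ?thesis
    unfolding is_ellipse_def by blast
qed

section \<open>Tangency\<close>

text \<open>The vectors \<open>p - c\<close> and \<open>v / r\<close> are orthonormal for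
  \<open>B\<close>, so the usual cosine-sine curve through them stays on the conic; dividing the
  sine by \<open>r\<close> makes its velocity at 0 exactly \<open>v\<close>.\<close>

lemma conic_tangent_vector:
  fixes B :: "'a::real_normed_vector \<Rightarrow> 'a \<Rightarrow> real"
  assumes B: "posdef_form B" and p: "p \<in> unit_conic B c" and pv: "B (p - c) v = 0" and v: "v \<noteq> 0"
  shows "tangent_vector (unit_conic B c) p v"
proof -
  define r where "r = sqrt (B v v)"
  have r: "0 < r" "r\<^sup>2 = B v v"
    using posdef_form_pos[OF B v] by (simp_all add: r_def)
  define \<phi> where "\<phi> t = c + (cos (r * t) *\<^sub>R (p - c) + (sin (r * t) / r) *\<^sub>R v)" for t
  have "\<phi> t \<in> unit_conic B c" for t
    using p pv r
    by (simp add: unit_conic_def \<phi>_def posdef_form_expand[OF B] power_divide flip: r(2))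
  moreover have "(\<phi> has_vector_derivative v) (at 0)"
    unfolding \<phi>_def using r(1)
    by (auto intro!: derivative_eq_intros simp: has_real_derivative_iff_has_vector_derivative[symmetric])
  ultimately show ?thesis
    unfolding tangent_vector_def by (intro exI[of _ \<phi>]) (simp add: \<phi>_def)
qed

lemma segment_tangent_vector:
  assumes "p \<in> open_segment A B"
  shows "tangent_vector (closed_segment A B) p (B - A)"
proof -
  obtain u where u: "0 < u" "u < 1" and p: "p = (1 - u) *\<^sub>R A + u *\<^sub>R B"
    using assms by (auto simp: in_segment)
  define \<phi> where "\<phi> t = p + t *\<^sub>R (B - A)" for t
  have "\<forall>\<^sub>F t in nhds 0. t \<in> {- u<..<1 - u}"
    by (rule eventually_nhds_in_open) (use u in auto)
  then have "\<forall>\<^sub>F t in nhds 0. \<phi> t \<in> closed_segment A B"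
  proof (rule eventually_mono)
    fix t assume "t \<in> {- u<..<1 - u}"
    moreover have "\<phi> t = (1 - (u + t)) *\<^sub>R A + (u + t) *\<^sub>R B"
      by (simp add: \<phi>_def p algebra_simps)
    ultimately show "\<phi> t \<in> closed_segment A B"
      unfolding in_segment by (intro exI[of _ "u + t"]) auto
  qed
  moreover have "(\<phi> has_vector_derivative (B - A)) (at 0)"
    unfolding \<phi>_def by (auto intro!: derivative_eq_intros)
  ultimately show ?thesis
    unfolding tangent_vector_def by (intro exI[of _ \<phi>]) (simp add: \<phi>_def)
qed

lemma tangent_at_mono: "tangent_at S S' p \<Longrightarrow> S' \<subseteq> S'' \<Longrightarrow> tangent_at S S'' p"
  unfolding tangent_at_def tangent_vector_def
  by (blast intro: eventually_mono)

section \<open>Quadratic forms along rays and lines\<close>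

text \<open>If the value at \<open>p\<close> were below 1, the form would grow from there to
  infinity along the ray and take the value 1 at some positive \<open>t\<close>.\<close>

lemma conic_outside:
  assumes B: "posdef_form B" and d: "d \<noteq> 0" and out: "\<And>t. 0 < t \<Longrightarrow> p + t *\<^sub>R d \<notin> unit_conic B c"
  shows "1 \<le> B (p - c) (p - c)"
proof (rule ccontr)
  define q m n where "q = B (p - c) (p - c)" and "m = B d d" and "n = B (p - c) d"
  assume "\<not> ?thesis"
  then have q: "q < 1"
    by (simp add: q_def)
  have m: "0 < m"
    using posdef_form_pos[OF B d] by (simp add: m_def)
  define w where "w = sqrt (n\<^sup>2 + m * (1 - q))"
  have w2: "w\<^sup>2 = n\<^sup>2 + m * (1 - q)"
    using m q by (simp add: w_def)
  have "\<bar>n\<bar> < w"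
    unfolding w_def using m q by (intro real_less_rsqrt) simp
  \<comment> \<open>The larger root of \<open>m * t\<^sup>2 + 2 * n * t + q = 1\<close>; it is
    positive because \<open>\<bar>n\<bar> < w\<close>.\<close>
  define t where "t = (w - n) / m"
  have t: "0 < t"
    using \<open>\<bar>n\<bar> < w\<close> m by (simp add: t_def)
  have tm: "t * m = w - n"
    using m by (simp add: t_def)
  have "m * (2 * t * n + t\<^sup>2 * m) = 2 * n * (t * m) + (t * m)\<^sup>2"
    by (simp add: power2_eq_square algebra_simps)
  also have "\<dots> = m * (1 - q)"
    unfolding tm using w2 by (simp add: power2_eq_square algebra_simps)
  finally have "2 * t * n + t\<^sup>2 * m = 1 - q"
    using m by simp
  then have "B ((p - c) + t *\<^sub>R d) ((p - c) + t *\<^sub>R d) = 1"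
    by (simp add: posdef_form_expand_line[OF B] flip: q_def m_def n_def)
  then have "p + t *\<^sub>R d \<in> unit_conic B c"
    by (simp add: unit_conic_def algebra_simps)
  then show False
    using out t by blast
qed

text \<open>Along the line, the form minus 1 is a nonnegative quadratic in \<open>t\<close> that
  vanishes at \<open>t = 0\<close>, so its linear coefficient is zero.\<close>

lemma conic_touching_line:
  assumes B: "posdef_form B" and p: "p \<in> unit_conic B c" and v: "v \<noteq> 0"
    and out: "\<And>t. 1 \<le> B (p + t *\<^sub>R v - c) (p + t *\<^sub>R v - c)"
  shows "B (p - c) v = 0"
proof -
  define m n where "m = B v v" and "n = B (p - c) v"
  have m: "0 < m"
    using posdef_form_pos[OF B v] by (simp add: m_def)
  \<comment> \<open>The minimiser of the quadratic, where the bound becomes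
    \<open>1 \<le> 1 - n\<^sup>2 / m\<close>.\<close>
  define t where "t = - n / m"
  have "p + t *\<^sub>R v - c = (p - c) + t *\<^sub>R v"
    by simp
  then have "1 \<le> B ((p - c) + t *\<^sub>R v) ((p - c) + t *\<^sub>R v)"
    using out by metis
  then have "1 \<le> 1 + 2 * t * n + t\<^sup>2 * m"
    unfolding posdef_form_expand_line[OF B] using p by (simp add: unit_conic_def m_def n_def)
  also have "\<dots> = 1 - n\<^sup>2 / m"
    using m by (simp add: t_def power2_eq_square field_simps)
  finally have "n\<^sup>2 / m \<le> 0"
    by simp
  then show ?thesis
    using m by (simp add: n_def divide_le_0_iff)
qed

section \<open>Triangles\<close>

text \<open>Cramer's rule: the determinant \<open>D\<close> of \<open>a\<close> and \<open>b\<close>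
  vanishes only if they are linearly dependent, and the coordinates are quotients of determinants by
  \<open>D\<close>.\<close>

lemma plane_coordinates:
  fixes a b :: "real^2"
  assumes "\<not> collinear {0, a, b}"
  obtains f g where "linear f" "linear g" "\<And>z. z = f z *\<^sub>R a + g z *\<^sub>R b"
    "\<And>x y. f (x *\<^sub>R a + y *\<^sub>R b) = x" "\<And>x y. g (x *\<^sub>R a + y *\<^sub>R b) = y"
proof -
  define D where "D = a $ 1 * b $ 2 - a $ 2 * b $ 1"
  have D: "D \<noteq> 0"
  proof
    assume D0: "D = 0"
    have a: "a \<noteq> 0" and nc: "\<And>r. b \<noteq> r *\<^sub>R a"
      using assms by (auto simp: collinear_lemma)
    from a have "a $ 1 \<noteq> 0 \<or> a $ 2 \<noteq> 0"
      by (auto simp: vec_eq_iff forall_2)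
    then show False
    proof
      assume "a $ 1 \<noteq> 0"
      then have "b = (b $ 1 / a $ 1) *\<^sub>R a"
        using D0 by (simp add: vec_eq_iff forall_2 D_def field_simps)
      with nc show False by blast
    next
      assume "a $ 2 \<noteq> 0"
      then have "b = (b $ 2 / a $ 2) *\<^sub>R a"
        using D0 by (simp add: vec_eq_iff forall_2 D_def field_simps)
      with nc show False by blast
    qed
  qed
  define f where "f z = (z $ 1 * b $ 2 - z $ 2 * b $ 1) / D" for z :: "real^2"
  define g where "g z = (a $ 1 * z $ 2 - a $ 2 * z $ 1) / D" for z :: "real^2"
  have "linear f" "linear g"
    by (auto simp: linear_iff f_def g_def algebra_simps add_divide_distrib diff_divide_distrib)
  moreover have "z = f z *\<^sub>R a + g z *\<^sub>R b" for z
  proof -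
    have "D * z $ i = D * (f z *\<^sub>R a + g z *\<^sub>R b) $ i" if "i = 1 \<or> i = 2" for i
    proof -
      have "D * (f z *\<^sub>R a + g z *\<^sub>R b) $ i = (D * f z) * a $ i + (D * g z) * b $ i"
        by (simp add: algebra_simps)
      also have "D * f z = z $ 1 * b $ 2 - z $ 2 * b $ 1"
        using D by (simp add: f_def)
      also have "D * g z = a $ 1 * z $ 2 - a $ 2 * z $ 1"
        using D by (simp add: g_def)
      finally show ?thesis
        using that by (auto simp: D_def algebra_simps)
    qed
    then show ?thesis
      using D by (simp add: vec_eq_iff forall_2)
  qed
  moreover have "f (x *\<^sub>R a + y *\<^sub>R b) = x" for x y
  proof -
    have "f (x *\<^sub>R a + y *\<^sub>R b) = x * D / D"
      by (simp add: f_def D_def algebra_simps)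
    then show ?thesis using D by simp
  qed
  moreover have "g (x *\<^sub>R a + y *\<^sub>R b) = y" for x y
  proof -
    have "g (x *\<^sub>R a + y *\<^sub>R b) = y * D / D"
      by (simp add: g_def D_def algebra_simps)
    then show ?thesis using D by simp
  qed
  ultimately show ?thesis
    by (rule that)
qed

lemma not_collinear_diff: "\<not> collinear {A, P, Q} \<longleftrightarrow> \<not> collinear {0, P - A, Q - A}"
  using collinear_3[of P A Q] by (simp add: insert_commute)

section \<open>Conics contained in a triangle\<close>

text \<open>From any point of the whole line through \<open>A\<close> and \<open>P\<close>, the ray
  in direction \<open>A - Q\<close> runs where the coordinate along \<open>Q - A\<close> is
  negative. It misses the triangle and hence the conic, so \<open>conic_outside\<close>
  applies.\<close>

lemma conic_in_triangle_side_outside: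
  fixes A P Q :: "real^2"
  assumes B: "posdef_form B" and nc: "\<not> collinear {A, P, Q}"
    and sub: "unit_conic B c \<subseteq> triangle_region A P Q"
  shows "1 \<le> B (A + x *\<^sub>R (P - A) - c) (A + x *\<^sub>R (P - A) - c)"
proof (rule conic_outside[OF B])
  show "A - Q \<noteq> 0"
    using nc by (auto simp: insert_commute)
next
  fix t :: real assume t: "0 < t"
  obtain f g where fg: "\<And>x y. f (x *\<^sub>R (P - A) + y *\<^sub>R (Q - A)) = x"
    "\<And>x y. g (x *\<^sub>R (P - A) + y *\<^sub>R (Q - A)) = (y::real)"
    using plane_coordinates nc not_collinear_diff by metis
  show "A + x *\<^sub>R (P - A) + t *\<^sub>R (A - Q) \<notin> unit_conic B c"
  proof
    assume "A + x *\<^sub>R (P - A) + t *\<^sub>R (A - Q) \<in> unit_conic B c"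
    then obtain u v where v: "0 \<le> v"
      and "A + x *\<^sub>R (P - A) + t *\<^sub>R (A - Q) = A + u *\<^sub>R (P - A) + v *\<^sub>R (Q - A)"
      using sub unfolding triangle_region_def convex_hull_3_alt by blast
    then have "x *\<^sub>R (P - A) + (- t) *\<^sub>R (Q - A) = u *\<^sub>R (P - A) + v *\<^sub>R (Q - A)"
      by (simp add: algebra_simps)
    then have "- t = v"
      using fg(2) by metis
    then show False
      using t v by simp
  qed
qed

text \<open>The lower bound holds on the whole side line, so \<open>p\<close> is a minimum there
  even when it is an endpoint of the segment.\<close>

lemma conic_in_triangle_touching_side:
  fixes A P Q :: "real^2"
  assumes B: "posdef_form B" and nc: "\<not> collinear {A, P, Q}"
    and sub: "unit_conic B c \<subseteq> triangle_region A P Q" and p: "p \<in> unit_conic B c" "p \<in> closed_segment A P"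
  shows "B (p - c) (P - A) = 0"
proof (rule conic_touching_line[OF B p(1)])
  show "P - A \<noteq> 0"
    using nc by auto
  obtain u where "p = (1 - u) *\<^sub>R A + u *\<^sub>R P"
    using p(2) by (auto simp: in_segment)
  then have "p + t *\<^sub>R (P - A) = A + (u + t) *\<^sub>R (P - A)" for t
    by (simp add: algebra_simps)
  then show "1 \<le> B (p + t *\<^sub>R (P - A) - c) (p + t *\<^sub>R (P - A) - c)" for t
    using conic_in_triangle_side_outside[OF B nc sub] by metis
qed

text \<open>The common tangent direction is \<open>P - A\<close>: conjugacy makes it tangent to the
  conic, and an interior point of the segment allows two-sided motion along the side.\<close>

lemma conic_in_triangle_tangent_at_side:
  fixes A P Q :: "real^2"
  assumes B: "posdef_form B" and nc: "\<not> collinear {A, P, Q}"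
    and sub: "unit_conic B c \<subseteq> triangle_region A P Q" and p: "p \<in> unit_conic B c" "p \<in> open_segment A P"
  shows "tangent_at (unit_conic B c) (closed_segment A P) p"
proof -
  have pc: "p \<in> closed_segment A P" and v: "P - A \<noteq> 0"
    using p(2) nc by (auto simp: open_segment_def)
  have "B (p - c) (P - A) = 0"
    by (rule conic_in_triangle_touching_side[OF B nc sub p(1) pc])
  then show ?thesis
    using conic_tangent_vector[OF B p(1) _ v] segment_tangent_vector[OF p(2)] p(1) pc v
    unfolding tangent_at_def by blast
qed

section \<open>Relabelling the vertices\<close>

lemma triangle_region_rotate: "triangle_region A B C = triangle_region B C A"
  by (simp add: triangle_region_def insert_commute)

lemma triangle_region_swap: "triangle_region A B C = triangle_region A C B"
  by (simp add: triangle_region_def insert_commute)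

lemma sides_rotate: "sides A B C = sides B C A"
  by (auto simp: sides_def)

lemma sides_swap: "sides A B C = sides A C B"
  by (auto simp: sides_def closed_segment_commute)

lemma inscribed_ellipse_rotate: "inscribed_ellipse E A B C = inscribed_ellipse E B C A"
  by (simp add: inscribed_ellipse_def triangle_region_rotate[of A B C] sides_rotate[of A B C])

lemma inscribed_ellipse_swap: "inscribed_ellipse E A B C = inscribed_ellipse E A C B"
  by (simp add: inscribed_ellipse_def triangle_region_swap[of A B C] sides_swap[of A B C])

lemma side_subset_frontier:
  assumes "S \<in> sides A B C"
  shows "S \<subseteq> frontier (triangle_region A B C)"
  using assms frontier_of_triangle[of A B C] by (auto simp: triangle_region_def sides_def)

section \<open>The tangent conic\<close>

text \<open>In the affine frame with origin the common vertex and unit points \<open>P1\<close>, \<open>P2\<close>, the conics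
  tangent to both axes at the unit points are \<open>(x + y - 1)\<^sup>2 = k x y\<close>, and tangency to the third
  side \<open>s x + t y = 1\<close> means \<open>k = 4 (1 - s) (1 - t)\<close>.\<close>

definition bitangent_conic :: "'a::real_vector \<Rightarrow> 'a \<Rightarrow> 'a \<Rightarrow> real \<Rightarrow> 'a set" where
  "bitangent_conic V a b k = {V + (x *\<^sub>R a + y *\<^sub>R b) | x y. (x + y - 1)\<^sup>2 = k * x * y}"

text \<open>Four times the quadratic part is
  \<open>(4 - k) * (x + y)\<^sup>2 + k * (x - y)\<^sup>2\<close>, which is positive definite exactly
  for \<open>0 < k < 4\<close>. Completing the square gives the centre.\<close>

lemma bitangent_conic_is_conic:
  fixes V a b :: "real^2"
  assumes nc: "\<not> collinear {0, a, b}" and k: "0 < k" "k < 4"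
  obtains B c where "posdef_form B" "bitangent_conic V a b k = unit_conic B c"
proof -
  obtain f g where lin: "linear f" "linear g" and z: "\<And>z. z = f z *\<^sub>R a + g z *\<^sub>R b"
    and fg: "\<And>x y. f (x *\<^sub>R a + y *\<^sub>R b) = x" "\<And>x y. g (x *\<^sub>R a + y *\<^sub>R b) = y"
    using plane_coordinates[OF nc] by metis
  \<comment> \<open>The polynomial \<open>(x + y - 1)\<^sup>2 - k * x * y\<close> takes the value
    \<open>- 1 / r\<close> at the centre, so scaling by \<open>r\<close> brings the level to
    1.\<close>
  define r where "r = (4 - k) / k"
  have r: "0 < r"
    using k by (simp add: r_def)
  define B where "B p q = r * (f p * f q + g p * g q + (1 - k / 2) * (f p * g q + f q * g p))" for p q
  \<comment> \<open>Both coordinates of the centre: the gradient vanishes at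
    \<open>x = y = m\<close> when \<open>m * (4 - k) = 2\<close>.\<close>
  define m where "m = 2 / (4 - k)"
  define c where "c = V + (m *\<^sub>R a + m *\<^sub>R b)"
  have "bilinear B"
    using lin by (auto simp: bilinear_def linear_iff B_def algebra_simps add_divide_distrib)
  moreover have "0 < B p p" if "p \<noteq> 0" for p
  proof -
    have "f p \<noteq> 0 \<or> g p \<noteq> 0"
      using z[of p] that by auto
    then have "0 < (f p + g p)\<^sup>2 \<or> 0 < (f p - g p)\<^sup>2"
      by auto
    then have "0 < (4 - k) * (f p + g p)\<^sup>2 + k * (f p - g p)\<^sup>2"
      using k by (meson add_nonneg_pos add_pos_nonneg diff_gt_0_iff_gt less_imp_le mult_nonneg_nonneg
          mult_pos_pos zero_le_power2)
    also have "\<dots> = 4 * (f p * f p + g p * g p + (1 - k / 2) * (f p * g p + f p * g p))"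
      by (simp add: power2_eq_square algebra_simps)
    finally show ?thesis
      using r by (simp add: B_def)
  qed
  ultimately have "posdef_form B"
    by (simp add: posdef_form_def) (simp add: B_def algebra_simps)
  moreover have "bitangent_conic V a b k = unit_conic B c"
  proof -
    have eq: "B (V + (x *\<^sub>R a + y *\<^sub>R b) - c) (V + (x *\<^sub>R a + y *\<^sub>R b) - c) = 1 \<longleftrightarrow>
        (x + y - 1)\<^sup>2 = k * x * y" for x y
    proof -
      have "V + (x *\<^sub>R a + y *\<^sub>R b) - c = (x - m) *\<^sub>R a + (y - m) *\<^sub>R b"
        by (simp add: c_def algebra_simps)
      then have "f (V + (x *\<^sub>R a + y *\<^sub>R b) - c) = x - m"
        "g (V + (x *\<^sub>R a + y *\<^sub>R b) - c) = y - m"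
        by (simp_all only: fg)
      then have "B (V + (x *\<^sub>R a + y *\<^sub>R b) - c) (V + (x *\<^sub>R a + y *\<^sub>R b) - c) =
          r * ((x - m)\<^sup>2 + (y - m)\<^sup>2 + (2 - k) * ((x - m) * (y - m)))"
        by (simp only: B_def) (simp add: power2_eq_square algebra_simps)
      also have "(x - m)\<^sup>2 + (y - m)\<^sup>2 + (2 - k) * ((x - m) * (y - m)) =
          x\<^sup>2 + y\<^sup>2 + (2 - k) * (x * y) - (m * (4 - k)) * (x + y) + m * (m * (4 - k))"
        by (simp add: power2_eq_square algebra_simps)
      also have "m * (4 - k) = 2"
        unfolding m_def by (rule nonzero_eq_divide_eq[THEN iffD1, OF _ refl]) (use k in simp)
      also have "x\<^sup>2 + y\<^sup>2 + (2 - k) * (x * y) - 2 * (x + y) + m * 2 =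
          ((x + y - 1)\<^sup>2 - k * x * y) + 1 / r"
      proof -
        have "m * 2 = 1 + 1 / r"
          using k by (simp add: m_def r_def field_simps)
        then show ?thesis
          by (simp add: power2_eq_square algebra_simps)
      qed
      finally have "B (V + (x *\<^sub>R a + y *\<^sub>R b) - c) (V + (x *\<^sub>R a + y *\<^sub>R b) - c) =
          r * ((x + y - 1)\<^sup>2 - k * x * y) + 1"
        using r by (simp add: algebra_simps)
      then show ?thesis
        using r by simp
    qed
    show ?thesis
    proof (rule set_eqI)
      fix p
      have p: "p = V + (f (p - V) *\<^sub>R a + g (p - V) *\<^sub>R b)"
        using z[of "p - V"] by (simp add: algebra_simps)
      show "p \<in> bitangent_conic V a b k \<longleftrightarrow> p \<in> unit_conic B c"
      proof
        assume "p \<in> bitangent_conic V a b k"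
        then show "p \<in> unit_conic B c"
          using eq by (auto simp: bitangent_conic_def unit_conic_def)
      next
        assume "p \<in> unit_conic B c"
        then have "(f (p - V) + g (p - V) - 1)\<^sup>2 = k * f (p - V) * g (p - V)"
          unfolding unit_conic_def mem_Collect_eq eq[symmetric] p[symmetric] .
        then show "p \<in> bitangent_conic V a b k"
          unfolding bitangent_conic_def using p by blast
      qed
    qed
  qed
  ultimately show ?thesis
    by (rule that)
qed

section \<open>Inequalities for the tangent conic and the double root\<close>

text \<open>The right-hand side of the equation is at most \<open>(x + y)\<^sup>2\<close>, which
  keeps \<open>x + y\<close> positive, while \<open>x * y\<close> is nonnegative. The bound for the
  third side is the inequality of arithmetic and geometric means for \<open>(1 - s) * x\<close> and
  \<open>(1 - t) * y\<close>.\<close>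

lemma bitangent_conic_bounds:
  fixes s t x y :: real
  assumes s: "0 < s" "s < 1" and t: "0 < t" "t < 1"
    and e: "(x + y - 1)\<^sup>2 = 4 * (1 - s) * (1 - t) * x * y"
  shows "0 \<le> x" "0 \<le> y" "s * x + t * y \<le> 1"
proof -
  \<comment> \<open>A quarter of the parameter that is passed to
    \<open>bitangent_conic\<close>.\<close>
  define k where "k = (1 - s) * (1 - t)"
  have "k < 1 * 1"
    unfolding k_def using s t by (intro mult_strict_mono) auto
  then have k: "0 < k" "k < 1"
    using s t by (auto simp: k_def)
  have e': "(x + y - 1)\<^sup>2 = 4 * (k * (x * y))"
    using e by (simp add: k_def)
  then have "0 \<le> k * (x * y)"
    by (metis zero_le_mult_iff zero_le_power2 not_numeral_le_zero)
  then have xy: "0 \<le> x * y"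
    using k by (simp add: zero_le_mult_iff)
  have "k * (x * y) \<le> 1 * (x * y)"
    using k xy by (intro mult_right_mono) auto
  then have "(x + y - 1)\<^sup>2 \<le> 4 * (x * y)"
    using e' by simp
  also have "\<dots> \<le> (x + y)\<^sup>2"
    using zero_le_power2[of "x - y"] by (simp add: power2_eq_square algebra_simps)
  finally have "1 / 2 \<le> x + y"
    by (simp add: power2_eq_square algebra_simps)
  then show x: "0 \<le> x" and y: "0 \<le> y"
    using xy by (auto simp: zero_le_mult_iff)
  have "(x + y - 1)\<^sup>2 \<le> ((1 - s) * x + (1 - t) * y)\<^sup>2"
    using e zero_le_power2[of "(1 - s) * x - (1 - t) * y"]
    by (simp add: power2_eq_square algebra_simps)
  then have "x + y - 1 \<le> (1 - s) * x + (1 - t) * y"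
    by (rule power2_le_imp_le) (use x y s t in auto)
  then show "s * x + t * y \<le> 1"
    by (simp add: algebra_simps)
qed

text \<open>The right side minus the left side is \<open>m * (A * (1 - u) - C * u)\<^sup>2 + (4 * m
  * A * C - n) * u * (1 - u)\<close>. Nonnegativity where the square vanishes gives
  \<open>n \<le> 4 * m * A * C\<close>; then at the zero \<open>x\<close> both summands vanish, and
  \<open>x\<close> is neither 0 nor 1.\<close>

lemma double_root_coefficient:
  fixes A C m n x :: real
  assumes A: "0 < A" and C: "0 < C" and m: "0 < m"
    and pos: "\<And>u. n * u * (1 - u) \<le> m * (A * (1 - u) + C * u)\<^sup>2"
    and x: "0 \<le> x" "x \<le> 1" and e: "n * x * (1 - x) = m * (A * (1 - x) + C * x)\<^sup>2"
  shows "n = 4 * m * A * C"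
proof -
  \<comment> \<open>The point at which \<open>A * (1 - u) = C * u\<close>.\<close>
  define u where "u = A / (A + C)"
  have AC: "0 < A + C"
    using A C by simp
  have u: "u * (A + C) = A" "(1 - u) * (A + C) = C"
    using AC by (simp_all add: u_def field_simps)
  have "n * u * (1 - u) * (A + C)\<^sup>2 \<le> m * (A * (1 - u) + C * u)\<^sup>2 * (A + C)\<^sup>2"
    by (rule mult_right_mono[OF pos]) simp
  then have "n * (u * (A + C)) * ((1 - u) * (A + C)) \<le>
      m * (A * ((1 - u) * (A + C)) + C * (u * (A + C)))\<^sup>2"
    by (simp add: power2_eq_square algebra_simps)
  then have "n * A * C \<le> m * (2 * A * C)\<^sup>2"
    unfolding u by (simp add: algebra_simps)
  then have "n * (A * C) \<le> (4 * m * A * C) * (A * C)"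
    by (simp add: power2_eq_square algebra_simps)
  then have n: "n \<le> 4 * m * A * C"
    using A C by (simp add: mult_le_cancel_right)
  have sum0: "m * (A * (1 - x) - C * x)\<^sup>2 + (4 * m * A * C - n) * (x * (1 - x)) = 0"
    using e by (simp add: power2_eq_square algebra_simps)
  have ge: "0 \<le> m * (A * (1 - x) - C * x)\<^sup>2" "0 \<le> (4 * m * A * C - n) * (x * (1 - x))"
    using m n x by simp_all
  then have z: "m * (A * (1 - x) - C * x)\<^sup>2 = 0" "(4 * m * A * C - n) * (x * (1 - x)) = 0"
    using sum0 by linarith+
  then have "A * (1 - x) = C * x"
    using m by simp
  then have "x \<noteq> 0" "1 - x \<noteq> 0"
    using A C by auto
  then show ?thesis
    using z(2) by simp
qed

section \<open>Uniqueness of the conic\<close>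

text \<open>In the coordinates along \<open>a\<close> and \<open>b\<close>, incidence and tangency
  at the unit points make all coefficients but that of \<open>x * y\<close> agree with
  \<open>\<zeta> * (x + y - 1)\<^sup>2\<close>. The double root on the third side fixes the
  remaining one.\<close>

lemma conic_eq_bitangent_conic:
  fixes V U W :: "real^2"
  assumes B: "posdef_form B" and nc: "\<not> collinear {V, U, W}"
    and sub: "unit_conic B c \<subseteq> triangle_region V U W"
    and s: "0 < s" "s < 1" and t: "0 < t" "t < 1"
    and a: "a = s *\<^sub>R (U - V)" and b: "b = t *\<^sub>R (W - V)"
    and P1: "V + a \<in> unit_conic B c" and P2: "V + b \<in> unit_conic B c"
    and P3: "P3 \<in> unit_conic B c" "P3 \<in> closed_segment U W"
  shows "unit_conic B c = bitangent_conic V a b (4 * (1 - s) * (1 - t))"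
proof -
  have bil: "bilinear B"
    using B by (simp add: posdef_form_def)
  define z where "z = V - c"
  define \<alpha> \<beta> \<gamma> \<delta> \<epsilon> \<zeta> where "\<alpha> = B a a" and "\<beta> = B a b" and "\<gamma> = B b b"
    and "\<delta> = B z a" and "\<epsilon> = B z b" and "\<zeta> = B z z - 1"
  have UV: "U - V \<noteq> 0"
    using nc by auto
  have Q: "B (V + (x *\<^sub>R a + y *\<^sub>R b) - c) (V + (x *\<^sub>R a + y *\<^sub>R b) - c) =
      \<alpha> * x\<^sup>2 + 2 * \<beta> * x * y + \<gamma> * y\<^sup>2 + 2 * \<delta> * x + 2 * \<epsilon> * y + \<zeta> + 1" for x y
  proof -
    have "V + (x *\<^sub>R a + y *\<^sub>R b) - c = z + (x *\<^sub>R a + y *\<^sub>R b)"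
      by (simp add: z_def)
    then show ?thesis
      by (simp only: posdef_form_expand_plane[OF B]) (simp add: \<alpha>_def \<beta>_def \<gamma>_def \<delta>_def \<epsilon>_def \<zeta>_def)
  qed
  have P1s: "V + a \<in> closed_segment V U"
    unfolding in_segment using s by (intro exI[of _ s]) (auto simp: a algebra_simps)
  have P2s: "V + b \<in> closed_segment V W"
    unfolding in_segment using t by (intro exI[of _ t]) (auto simp: b algebra_simps)
  have nc2: "\<not> collinear {V, W, U}" and nc3: "\<not> collinear {U, W, V}"
    using nc by (simp_all add: insert_commute)
  have sub2: "unit_conic B c \<subseteq> triangle_region V W U" and sub3: "unit_conic B c \<subseteq> triangle_region U W V"
    using sub by (simp_all add: triangle_region_def insert_commute)
  have "B (V + a - c) (U - V) = 0"
    by (rule conic_in_triangle_touching_side[OF B nc sub P1 P1s])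
  then have "B (z + a) a = 0"
    by (simp add: z_def a bilinear_rmul[OF bil] add_diff_eq diff_add_eq)
  then have d1: "\<delta> = - \<alpha>"
    by (simp add: \<alpha>_def \<delta>_def bilinear_ladd[OF bil])
  have "B (V + b - c) (W - V) = 0"
    by (rule conic_in_triangle_touching_side[OF B nc2 sub2 P2 P2s])
  then have "B (z + b) b = 0"
    by (simp add: z_def b bilinear_rmul[OF bil] add_diff_eq diff_add_eq)
  then have d2: "\<epsilon> = - \<gamma>"
    by (simp add: \<gamma>_def \<epsilon>_def bilinear_ladd[OF bil])
  have z1: "\<zeta> = \<alpha>"
    using P1 Q[of 1 0] d1 by (simp add: unit_conic_def)
  have z2: "\<zeta> = \<gamma>"
    using P2 Q[of 0 1] d2 by (simp add: unit_conic_def)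
  have m: "0 < \<zeta>"
    unfolding z1 \<alpha>_def using s UV by (intro posdef_form_pos[OF B]) (simp add: a)
  \<comment> \<open>Dividing by \<open>s * t\<close> turns the cross term into
    \<open>n * u * (1 - u)\<close> on the third side, where \<open>x = (1 - u) / s\<close> and
    \<open>y = u / t\<close>.\<close>
  define n where "n = (2 * \<zeta> - 2 * \<beta>) / (s * t)"
  have Q': "B (V + (x *\<^sub>R a + y *\<^sub>R b) - c) (V + (x *\<^sub>R a + y *\<^sub>R b) - c) =
      \<zeta> * (x + y - 1)\<^sup>2 - n * s * t * x * y + 1" for x y
  proof -
    have \<beta>: "\<beta> = \<zeta> - n * s * t / 2"
      using s t by (simp add: n_def field_simps)
    show ?thesis
      unfolding Q d1 d2 \<beta> z1[symmetric] z2[symmetric]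
      by (simp add: power2_eq_square algebra_simps)
  qed
  \<comment> \<open>The values of \<open>x + y - 1\<close> at the vertices \<open>U\<close> and
    \<open>W\<close>.\<close>
  define A C where "A = (1 - s) / s" and "C = (1 - t) / t"
  have AC: "0 < A" "0 < C"
    using s t by (simp_all add: A_def C_def)
  have side: "U + u *\<^sub>R (W - U) = V + (((1 - u) / s) *\<^sub>R a + (u / t) *\<^sub>R b)" for u
  proof -
    have "((1 - u) / s) *\<^sub>R a = (1 - u) *\<^sub>R (U - V)" "(u / t) *\<^sub>R b = u *\<^sub>R (W - V)"
      using s t by (simp_all add: a b)
    then show ?thesis
      by (simp only:) (simp add: algebra_simps)
  qed
  have Qs: "B (U + u *\<^sub>R (W - U) - c) (U + u *\<^sub>R (W - U) - c) =
      \<zeta> * (A * (1 - u) + C * u)\<^sup>2 - n * u * (1 - u) + 1" for u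
  proof -
    have "(1 - u) / s + u / t - 1 = A * (1 - u) + C * u"
      using s t by (simp add: A_def C_def field_simps)
    moreover have "n * s * t * ((1 - u) / s) * (u / t) = n * u * (1 - u)"
      using s t by (simp add: field_simps)
    ultimately show ?thesis
      unfolding side Q' by simp
  qed
  obtain u where u: "0 \<le> u" "u \<le> 1" and P3u: "P3 = U + u *\<^sub>R (W - U)"
    using P3(2) by (auto simp: in_segment algebra_simps)
  have "n = 4 * \<zeta> * A * C"
  proof (rule double_root_coefficient[OF AC m _ u])
    show "n * v * (1 - v) \<le> \<zeta> * (A * (1 - v) + C * v)\<^sup>2" for v
      using conic_in_triangle_side_outside[OF B nc3 sub3, of v] unfolding Qs by simp
    show "n * u * (1 - u) = \<zeta> * (A * (1 - u) + C * u)\<^sup>2"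
      using P3(1) Qs[of u] by (simp add: unit_conic_def P3u)
  qed
  then have nst: "n * s * t = 4 * \<zeta> * (1 - s) * (1 - t)"
    using s t by (simp add: A_def C_def)
  have eq: "B (V + (x *\<^sub>R a + y *\<^sub>R b) - c) (V + (x *\<^sub>R a + y *\<^sub>R b) - c) = 1 \<longleftrightarrow>
      (x + y - 1)\<^sup>2 = 4 * (1 - s) * (1 - t) * x * y" for x y
  proof -
    have "\<zeta> * (x + y - 1)\<^sup>2 - n * s * t * x * y =
        \<zeta> * ((x + y - 1)\<^sup>2 - 4 * (1 - s) * (1 - t) * x * y)"
      unfolding nst by (simp add: algebra_simps)
    then show ?thesis
      unfolding Q' using m by simp
  qed
  have coords: "\<exists>x y. p = V + (x *\<^sub>R a + y *\<^sub>R b)" for p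
  proof -
    obtain f g where "\<And>z. z = f z *\<^sub>R (U - V) + g z *\<^sub>R (W - V)"
      using plane_coordinates nc not_collinear_diff by metis
    from this[of "p - V"] have "p = V + ((f (p - V) / s) *\<^sub>R a + (g (p - V) / t) *\<^sub>R b)"
      using s t by (simp add: a b algebra_simps)
    then show ?thesis by blast
  qed
  show ?thesis
  proof (rule set_eqI)
    fix p
    obtain x y where p: "p = V + (x *\<^sub>R a + y *\<^sub>R b)"
      using coords by blast
    show "p \<in> unit_conic B c \<longleftrightarrow> p \<in> bitangent_conic V a b (4 * (1 - s) * (1 - t))"
    proof
      assume "p \<in> unit_conic B c"
      then have "(x + y - 1)\<^sup>2 = 4 * (1 - s) * (1 - t) * x * y"
        unfolding unit_conic_def mem_Collect_eq p eq .
      then show "p \<in> bitangent_conic V a b (4 * (1 - s) * (1 - t))"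
        unfolding bitangent_conic_def using p by blast
    next
      assume "p \<in> bitangent_conic V a b (4 * (1 - s) * (1 - t))"
      then show "p \<in> unit_conic B c"
        using eq by (auto simp: bitangent_conic_def unit_conic_def)
    qed
  qed
qed

section \<open>Existence of the conic\<close>

text \<open>\<open>s * x\<close> and \<open>t * y\<close> are the barycentric coordinates at
  \<open>U\<close> and \<open>W\<close>, so \<open>bitangent_conic_bounds\<close> supplies the
  inequalities that describe the triangle.\<close>

lemma bitangent_conic_in_triangle:
  fixes V U W :: "'a::real_vector"
  assumes s: "0 < s" "s < 1" and t: "0 < t" "t < 1"
    and a: "a = s *\<^sub>R (U - V)" and b: "b = t *\<^sub>R (W - V)"
  shows "bitangent_conic V a b (4 * (1 - s) * (1 - t)) \<subseteq> convex hull {V, U, W}"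
proof
  fix p assume "p \<in> bitangent_conic V a b (4 * (1 - s) * (1 - t))"
  then obtain x y where p: "p = V + (x *\<^sub>R a + y *\<^sub>R b)"
    and e: "(x + y - 1)\<^sup>2 = 4 * (1 - s) * (1 - t) * x * y"
    by (auto simp: bitangent_conic_def)
  note bounds = bitangent_conic_bounds[OF s t e]
  have "p = V + (s * x) *\<^sub>R (U - V) + (t * y) *\<^sub>R (W - V)"
    by (simp add: p a b mult.commute)
  moreover have "0 \<le> s * x" "0 \<le> t * y"
    using bounds s t by simp_all
  ultimately show "p \<in> convex hull {V, U, W}"
    unfolding convex_hull_3_alt using bounds(3) by blast
qed

text \<open>The contact point is the equality case of the means inequality:
  \<open>(1 - s) * x = (1 - t) * y\<close> together with \<open>s * x + t * y = 1\<close>.\<close>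

lemma bitangent_conic_meets_third_side:
  fixes V U W :: "'a::real_vector"
  assumes s: "0 < s" "s < 1" and t: "0 < t" "t < 1" and UW: "U \<noteq> W"
    and a: "a = s *\<^sub>R (U - V)" and b: "b = t *\<^sub>R (W - V)"
  obtains p where "p \<in> bitangent_conic V a b (4 * (1 - s) * (1 - t))" "p \<in> open_segment U W"
proof -
  \<comment> \<open>The normalising factor that puts the point proportional to
    \<open>(1 - t, 1 - s)\<close> on the third side.\<close>
  define d where "d = s * (1 - t) + t * (1 - s)"
  have d: "0 < s * (1 - t)" "0 < t * (1 - s)" "0 < d"
    using s t by (simp_all add: d_def add_pos_pos)
  define x y where "x = (1 - t) / d" and "y = (1 - s) / d"
  have xy: "s * x + t * y = 1"
    using d by (simp add: x_def y_def d_def flip: add_divide_distrib)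
  have m: "(1 - s) * x = (1 - t) * y"
    by (simp add: x_def y_def)
  have "x + y - 1 = (1 - s) * x + (1 - t) * y"
    using xy by (simp add: algebra_simps)
  also have "\<dots> = 2 * ((1 - s) * x)"
    using m by simp
  finally have "(x + y - 1)\<^sup>2 = 4 * ((1 - s) * x) * ((1 - s) * x)"
    by (simp add: power2_eq_square)
  also have "\<dots> = 4 * ((1 - s) * x) * ((1 - t) * y)"
    using m by simp
  finally have "(x + y - 1)\<^sup>2 = 4 * (1 - s) * (1 - t) * x * y"
    by (simp add: mult_ac)
  then have "V + (x *\<^sub>R a + y *\<^sub>R b) \<in> bitangent_conic V a b (4 * (1 - s) * (1 - t))"
    unfolding bitangent_conic_def by blast
  moreover have "V + (x *\<^sub>R a + y *\<^sub>R b) \<in> open_segment U W"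
  proof -
    have sx: "s * x = 1 - t * y"
      using xy by simp
    have "V + (x *\<^sub>R a + y *\<^sub>R b) = V + (s * x) *\<^sub>R (U - V) + (t * y) *\<^sub>R (W - V)"
      by (simp add: a b mult.commute)
    also have "\<dots> = (1 - t * y) *\<^sub>R U + (t * y) *\<^sub>R W"
      unfolding sx by (simp add: algebra_simps)
    finally have "V + (x *\<^sub>R a + y *\<^sub>R b) = (1 - t * y) *\<^sub>R U + (t * y) *\<^sub>R W" .
    moreover have "0 < t * y" "0 < s * x"
      using s t d by (simp_all add: x_def y_def)
    then have "0 < t * y" "t * y < 1"
      using xy by simp_all
    ultimately show ?thesis
      using UW unfolding in_segment by blast
  qed
  ultimately show ?thesis
    by (rule that)
qed

section \<open>Assembly and choice of the common vertex\<close>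

text \<open>The bitangent conic lies in the triangle and meets the three sides at interior points,
  hence is tangent there. Any competitor is a conic in the triangle through \<open>P1\<close>,
  \<open>P2\<close> and a point of the third side, so \<open>conic_eq_bitangent_conic\<close>
  identifies it.\<close>

lemma ex1_inscribed_ellipse:
  fixes V U W P1 P2 :: "real^2"
  assumes nc: "\<not> collinear {V, U, W}"
    and P1: "P1 \<in> open_segment V U" and P2: "P2 \<in> open_segment V W"
  shows "\<exists>!E. inscribed_ellipse E V U W \<and>
           tangent_at E (frontier (triangle_region V U W)) P1 \<and>
           tangent_at E (frontier (triangle_region V U W)) P2"
proof -
  obtain s where s: "0 < s" "s < 1" and P1s: "P1 = (1 - s) *\<^sub>R V + s *\<^sub>R U"
    using P1 by (auto simp: in_segment)
  obtain t where t: "0 < t" "t < 1" and P2t: "P2 = (1 - t) *\<^sub>R V + t *\<^sub>R W"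
    using P2 by (auto simp: in_segment)
  define a b where "a = s *\<^sub>R (U - V)" and "b = t *\<^sub>R (W - V)"
  define k where "k = 4 * (1 - s) * (1 - t)"
  have P1a: "P1 = V + a" and P2b: "P2 = V + b"
    by (simp_all add: P1s P2t a_def b_def algebra_simps)
  have UW: "U \<noteq> W"
    using nc by (auto simp: insert_commute)
  have nc2: "\<not> collinear {V, W, U}" and nc3: "\<not> collinear {U, W, V}"
    using nc by (simp_all add: insert_commute)
  have "(1 - s) * (1 - t) < 1 * 1"
    using s t by (intro mult_strict_mono) auto
  then have k: "0 < k" "k < 4"
    using s t by (simp_all only: k_def mult.assoc) simp_all
  have "\<not> collinear {0, a, b}"
  proof -
    obtain f g where fg: "\<And>x y. f (x *\<^sub>R (U - V) + y *\<^sub>R (W - V)) = x"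
        "\<And>x y. g (x *\<^sub>R (U - V) + y *\<^sub>R (W - V)) = (y::real)"
      using plane_coordinates nc not_collinear_diff by metis
    \<comment> \<open>The coordinates along \<open>W - V\<close> differ: \<open>t\<close> on the
      left, 0 on the right.\<close>
    have "b \<noteq> r *\<^sub>R a" for r
      using fg(2)[of 0 t] fg(2)[of "r * s" 0] t by (auto simp: a_def b_def)
    moreover have "a \<noteq> 0" "b \<noteq> 0"
      using s t nc by (auto simp: a_def b_def insert_commute)
    ultimately show ?thesis
      by (simp add: collinear_lemma)
  qed
  then obtain B c where B: "posdef_form B" and K: "bitangent_conic V a b k = unit_conic B c"
    using bitangent_conic_is_conic[of a b k V] k by blast
  have sub: "unit_conic B c \<subseteq> triangle_region V U W"
    using bitangent_conic_in_triangle[OF s t a_def b_def]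
    by (simp only: triangle_region_def flip: K k_def)
  then have sub2: "unit_conic B c \<subseteq> triangle_region V W U" and sub3: "unit_conic B c \<subseteq> triangle_region U W V"
    by (simp_all add: triangle_region_def insert_commute)
  have P1K: "P1 \<in> unit_conic B c"
    unfolding K[symmetric] bitangent_conic_def P1a
    by (intro CollectI exI[of _ 1] exI[of _ 0]) simp
  have P2K: "P2 \<in> unit_conic B c"
    unfolding K[symmetric] bitangent_conic_def P2b
    by (intro CollectI exI[of _ 0] exI[of _ 1]) simp
  obtain P3 where P3: "P3 \<in> unit_conic B c" "P3 \<in> open_segment U W"
    using bitangent_conic_meets_third_side[OF s t UW a_def b_def] unfolding k_def[symmetric] K
    by blast
  have T1: "tangent_at (unit_conic B c) (closed_segment V U) P1"
    by (rule conic_in_triangle_tangent_at_side[OF B nc sub P1K P1])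
  have T2: "tangent_at (unit_conic B c) (closed_segment V W) P2"
    by (rule conic_in_triangle_tangent_at_side[OF B nc2 sub2 P2K P2])
  have T3: "tangent_at (unit_conic B c) (closed_segment U W) P3"
    by (rule conic_in_triangle_tangent_at_side[OF B nc3 sub3 P3])
  show ?thesis
  proof (rule ex1I[of _ "unit_conic B c"], intro conjI)
    show "inscribed_ellipse (unit_conic B c) V U W"
      unfolding inscribed_ellipse_def sides_def
      using conic_is_ellipse[OF B] sub T1 T2 T3 by (auto simp: closed_segment_commute)
    \<comment> \<open>The side lies in the frontier, so curves along the side are also curves in the
      frontier.\<close>
    show "tangent_at (unit_conic B c) (frontier (triangle_region V U W)) P1"
      by (rule tangent_at_mono[OF T1]) (simp add: side_subset_frontier sides_def)
    show "tangent_at (unit_conic B c) (frontier (triangle_region V U W)) P2"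
      by (rule tangent_at_mono[OF T2])
        (simp add: side_subset_frontier sides_def closed_segment_commute)
  next
    fix E assume E: "inscribed_ellipse E V U W \<and>
      tangent_at E (frontier (triangle_region V U W)) P1 \<and>
      tangent_at E (frontier (triangle_region V U W)) P2"
    then obtain B' c' where B': "posdef_form B'" and E': "E = unit_conic B' c'"
      unfolding inscribed_ellipse_def using ellipse_is_conic by metis
    have sub': "unit_conic B' c' \<subseteq> triangle_region V U W"
      using E by (simp add: inscribed_ellipse_def E')
    have "V + a \<in> unit_conic B' c'" "V + b \<in> unit_conic B' c'"
      using E by (simp_all add: tangent_at_def E' P1a P2b)
    moreover obtain P where "P \<in> unit_conic B' c'" "P \<in> closed_segment U W"
      using E by (auto simp: inscribed_ellipse_def sides_def tangent_at_def E')
    ultimately have "unit_conic B' c' = bitangent_conic V a b (4 * (1 - s) * (1 - t))"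
      by (rule conic_eq_bitangent_conic[OF B' nc sub' s t a_def b_def])
    then show "E = unit_conic B c"
      by (simp add: E' k_def flip: K)
  qed
qed

theorem theorem3p1:
  fixes A B C P1 P2 :: "real^2"
  assumes "\<not> collinear {A, B, C}"
    and "P1 \<noteq> P2"
    and "\<exists>s1 \<in> sides A B C. \<exists>s2 \<in> sides A B C. s1 \<noteq> s2 \<and> P1 \<in> s1 \<and> P2 \<in> s2"
    and "P1 \<notin> {A, B, C}" and "P2 \<notin> {A, B, C}"
  shows "\<exists>!E. inscribed_ellipse E A B C \<and>
           tangent_at E (frontier (triangle_region A B C)) P1 \<and>
           tangent_at E (frontier (triangle_region A B C)) P2"
proof -
  let ?D = "\<lambda>V U W. \<exists>!E. inscribed_ellipse E V U W \<and>
           tangent_at E (frontier (triangle_region V U W)) P1 \<and>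
           tangent_at E (frontier (triangle_region V U W)) P2"
  have rot: "?D V U W = ?D U W V" for V U W
    by (simp add: inscribed_ellipse_rotate[of _ V U W] triangle_region_rotate[of V U W])
  have swap: "?D V U W = ?D V W U" for V U W
    by (simp add: inscribed_ellipse_swap[of _ V U W] triangle_region_swap[of V U W])
  \<comment> \<open>Rewrites the claim for every relabelling of the vertices to the order
    \<open>A\<close>, \<open>B\<close>, \<open>C\<close>.\<close>
  note perms = swap[of A C B] rot[of A B C, symmetric] rot[of C A B]
    trans[OF swap[of B A C] rot[of A B C, symmetric]] trans[OF swap[of C B A] rot[of C A B]]
  have nc: "\<not> collinear {A, C, B}" "\<not> collinear {B, C, A}" "\<not> collinear {B, A, C}"
    "\<not> collinear {C, A, B}" "\<not> collinear {C, B, A}"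
    using assms(1) by (simp_all add: insert_commute)
  have seg: "P \<in> open_segment X Y"
    if "P \<in> closed_segment X Y \<or> P \<in> closed_segment Y X" "P \<notin> {A, B, C}"
      "X \<in> {A, B, C}" "Y \<in> {A, B, C}" for P X Y
    using that by (auto simp: open_segment_def closed_segment_commute)
  note seg1 = seg[OF _ assms(4)] and seg2 = seg[OF _ assms(5)]
  obtain s1 s2 where s12: "s1 \<in> sides A B C" "s2 \<in> sides A B C" "s1 \<noteq> s2" "P1 \<in> s1" "P2 \<in> s2"
    using assms(3) by blast
  \<comment> \<open>In each ordered pair of distinct sides, the common vertex is taken first,
    followed by the other end of the side of \<open>P1\<close> and then that of
    \<open>P2\<close>.\<close>
  then consider "P1 \<in> closed_segment A B" "P2 \<in> closed_segment B C"
    | "P1 \<in> closed_segment A B" "P2 \<in> closed_segment C A"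
    | "P1 \<in> closed_segment B C" "P2 \<in> closed_segment A B"
    | "P1 \<in> closed_segment B C" "P2 \<in> closed_segment C A"
    | "P1 \<in> closed_segment C A" "P2 \<in> closed_segment A B"
    | "P1 \<in> closed_segment C A" "P2 \<in> closed_segment B C"
    unfolding sides_def by fast
  then show ?thesis
  proof cases
    case 1
    then have "?D B A C"
      by (intro ex1_inscribed_ellipse nc seg1 seg2) auto
    then show ?thesis by (simp only: perms)
  next
    case 2
    then show ?thesis
      by (intro ex1_inscribed_ellipse assms(1) seg1 seg2) auto
  next
    case 3
    then have "?D B C A"
      by (intro ex1_inscribed_ellipse nc seg1 seg2) auto
    then show ?thesis by (simp only: perms)
  next
    case 4
    then have "?D C B A"
      by (intro ex1_inscribed_ellipse nc seg1 seg2) auto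
    then show ?thesis by (simp only: perms)
  next
    case 5
    then have "?D A C B"
      by (intro ex1_inscribed_ellipse nc seg1 seg2) auto
    then show ?thesis by (simp only: perms)
  next
    case 6
    then have "?D C A B"
      by (intro ex1_inscribed_ellipse nc seg1 seg2) auto
    then show ?thesis by (simp only: perms)
  qed
qed

end
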